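(* Suppose Assumption 1 holds with $\alpha\in(0,1]$, and let $(f_t)_{t\in\mathbb N}$ be the online gradient descent iterates with step sizes satisfying $\eta_t\le\frac{1}{A\kappa^2}$ and $\eta_{t+1}\le\eta_t$ for all $t\in\mathbb N$, and $\sum_{t=1}^\infty\eta_t^2<\infty$. Then there is a constant $\widetilde C$ independent of $T$ and $\delta$ such that for every $T\in\mathbb N$ and every $\delta\in(0,1)$, with probability at least $1-\delta$, $$\sum_{t=1}^{T}\eta_t\big[\mathcal E(f_t)-\mathcal E(f_H)\big]\le\widetilde C\log^{3/2}\frac{2T}{\delta}\qquad\text{and}\qquad \mathcal E(\bar f_T^\eta)-\mathcal E(f_H)\le\frac{\widetilde C\log^{3/2}\frac{2T}{\delta}}{\sum_{t=1}^T\eta_t}.$$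
   Context: Setting: Let $\mathcal X\subset\mathbb R^d$, $\mathcal Y\subset\mathbb R$, $\mathcal Z=\mathcal X\times\mathcal Y$, and let $\rho$ be a Borel probability measure on $\mathcal Z$. Let $K:\mathcal X\times\mathcal X\to\mathbb R$ be a continuous, symmetric, positive semi-definite kernel with reproducing kernel Hilbert space $H_K$ (inner product $\langle\cdot,\cdot\rangle$, norm $\|\cdot\|$), $K_x:=K(x,\cdot)$, reproducing property $f(x)=\langle f,K_x\rangle$, and $\kappa:=\sup_{x\in\mathcal X}\sqrt{K(x,x)}<\infty$. Let $\phi:\mathcal Y\times\mathbb R\to[0,\infty)$ be a loss function, differentiable in its second argument, and write $\phi'(y,s)$ for its derivative with respect to $s$. The generalization error of $f:\mathcal X\to\mathbb R$ is $\mathcal E(f)=\int_{\mathcal Z}\phi(y,f(x))\,d\rho(x,y)$. It is assumed that a minimizer $f_H\in\arg\min_{f\in H_K}\mathcal E(f)$ exists and that $\max\{\sup_{y\in\mathcal Y}\phi(y,0),\ \sup_{(x,y)\in\mathcal Z}\phi(y,f_H(x))\}<\infty$. Let $z_t=(x_t,y_t)$, $t\in\mathbb N$, be i.i.d. samples from $\rho$, let $(\eta_t)_{t\in\mathbb N}$ be positive step sizes, and define the online gradient descent iterates by $f_1=0$ and $f_{t+1}=f_t-\eta_t\phi'(y_t,f_t(x_t))K_{x_t}$ for $t\in\mathbb N$ (so $f_t$ depends only on $z_1,\dots,z_{t-1}$). Assumption 1: for every $y\in\mathcal Y$, $\phi(y,\cdot)$ is convex and differentiable, and there are constants $\alpha\in(0,1]$,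 $L>0$ with $|\phi'(y,s)-\phi'(y,\tilde s)|\le L|s-\tilde s|^{\alpha}$ for all $s,\tilde s\in\mathbb R$, $y\in\mathcal Y$. Constants: $A=2\alpha^{\frac{1-\alpha}{1+\alpha}}L^{\frac{2}{1+\alpha}}(1+\alpha)$ and $B=\alpha^{-\frac{2\alpha}{1+\alpha}}L^{\frac{2}{1+\alpha}}(1-\alpha^2)$. Weighted average: $\bar f_T^\eta:=\big(\sum_{t=1}^T\eta_t f_t\big)/\sum_{t=1}^T\eta_t$. *)

theory Defs
  imports "HOL-Analysis.Analysis" "HOL-Probability.Probability"
begin

text \<open>The RKHS H_K is modelled as a real Hilbert space 'h together with the
  canonical feature map kx (x |-> K_x); evaluation is f(x) = inner f (kx x),
  and the kernel is K x x' = inner (kx x) (kx x').\<close>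

definition kern :: "('a \<Rightarrow> 'h::real_inner) \<Rightarrow> 'a \<Rightarrow> 'a \<Rightarrow> real" where
  "kern kx x x' = inner (kx x) (kx x')"

definition evalf :: "('a \<Rightarrow> 'h::real_inner) \<Rightarrow> 'h \<Rightarrow> 'a \<Rightarrow> real" where
  "evalf kx f = (\<lambda>x. inner f (kx x))"

definition kappa :: "('a \<Rightarrow> 'h::real_inner) \<Rightarrow> 'a set \<Rightarrow> real" where
  "kappa kx X = (SUP x\<in>X. sqrt (kern kx x x))"

definition gen_err :: "('a \<times> real) measure \<Rightarrow> (real \<Rightarrow> real \<Rightarrow> real) \<Rightarrow> ('a \<Rightarrow> real) \<Rightarrow> real" where
  "gen_err \<rho> phi f = (\<integral>z. phi (snd z) (f (fst z)) \<partial>\<rho>)"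

text \<open>Online gradient descent iterates: ogd ... z t = f_t for t >= 1
  (f_1 = 0, f_{t+1} = f_t - eta_t phi'(y_t, f_t(x_t)) K_{x_t}), where z t = (x_t, y_t).
  The value at t = 0 is irrelevant (set to 0).\<close>
fun ogd :: "('a \<Rightarrow> 'h::real_inner) \<Rightarrow> (real \<Rightarrow> real \<Rightarrow> real) \<Rightarrow> (nat \<Rightarrow> real)
    \<Rightarrow> (nat \<Rightarrow> 'a \<times> real) \<Rightarrow> nat \<Rightarrow> 'h" where
  "ogd kx dphi eta z 0 = 0"
| "ogd kx dphi eta z (Suc 0) = 0"
| "ogd kx dphi eta z (Suc (Suc n)) =
     ogd kx dphi eta z (Suc n)
     - (eta (Suc n) * dphi (snd (z (Suc n))) (inner (ogd kx dphi eta z (Suc n)) (kx (fst (z (Suc n))))))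
       *\<^sub>R kx (fst (z (Suc n)))"

definition wavg :: "(nat \<Rightarrow> real) \<Rightarrow> (nat \<Rightarrow> 'h::real_vector) \<Rightarrow> nat \<Rightarrow> 'h" where
  "wavg eta f T = (1 / (\<Sum>t=1..T. eta t)) *\<^sub>R (\<Sum>t=1..T. eta t *\<^sub>R f t)"

definition constA :: "real \<Rightarrow> real \<Rightarrow> real" where
  "constA \<alpha> L = 2 * \<alpha> powr ((1 - \<alpha>) / (1 + \<alpha>)) * L powr (2 / (1 + \<alpha>)) * (1 + \<alpha>)"

end

theory Submission
  imports Defs
begin

text \<open>
  The loss is self-bounding, phi'^2 \<le> A phi + B. Let D t be the squared distance of the
  t-th iterate to fH and U t the excess loss of the t-th iterate on the t-th sample, with
  conditional mean E t, the excess risk. Weighting the one-step inequality for D by the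
  decreasing step sizes gives the deterministic bounds eta t * D t \<le> c and
  \<Sum>t. eta t ^ 2 * phi t \<le> c, hence also D t \<le> Q t = C - 2 * (\<Sum>k<t. eta k * U k).
  Since U is bounded below and its second moment is at most a multiple of D t * (A * E t + c'),
  the bound on eta t * D t lets the linear term absorb the part of the variance containing E t:
  the conditional expectation of exp (- 2 * e * eta t * U t) is at most
  exp (- e * eta t * E t + c'' * e ^ 2 * eta t ^ 2 * Q t). The remaining variance is paid for by
  letting the exponent e decrease slightly at each step, which costs only a bounded total amount
  because eta is square-summable. So (\<Sum>t. eta t * E t) has a bounded exponential moment,
  uniformly in T, and Markov's inequality even gives a bound of order ln (1/\<delta>).
\<close>

section \<open>Self-bounding property of smooth convex losses\<close>

text \<open>Only an upper bound on \<open>v\<close> is assumed, which fits exponents that are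
  negative multiples of an excess loss: the excess is bounded below. For \<open>v = - a < 0\<close>,
  multiplying \<open>1 - a + a\<^sup>2\<close> by the quadratic Taylor polynomial of
  \<open>exp a\<close> cancels the linear term and leaves at least 1.\<close>

lemma exp_le_quadratic:
  fixes v :: real
  assumes "v \<le> 1"
  shows "exp v \<le> 1 + v + v\<^sup>2"
proof (cases "v \<ge> 0")
  case True
  then show ?thesis using assms exp_bound by blast
next
  case False
  define a where "a = - v"
  have a: "a > 0" using False by (simp add: a_def)
  have "1 \<le> (1 - a + a\<^sup>2) * (1 + a + a\<^sup>2 / 2)"
  proof -
    have "(1 - a + a\<^sup>2) * (1 + a + a\<^sup>2 / 2) = 1 + a\<^sup>2 / 2 + a ^ 3 / 2 + a ^ 4 / 2"
      by (simp add: field_simps power2_eq_square power3_eq_cube power4_eq_xxxx)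
    then show ?thesis using a by simp
  qed
  also have "\<dots> \<le> (1 - a + a\<^sup>2) * exp a"
  proof (rule mult_left_mono)
    show "1 + a + a\<^sup>2 / 2 \<le> exp a" using exp_lower_Taylor_quadratic a by simp
    have "1 - a + a\<^sup>2 = (1 - a / 2)\<^sup>2 + 3 / 4 * a\<^sup>2" by (simp add: field_simps power2_eq_square)
    then show "0 \<le> 1 - a + a\<^sup>2" by simp
  qed
  finally have "exp (- a) \<le> 1 - a + a\<^sup>2"
    by (simp add: exp_minus field_simps)
  then show ?thesis by (simp add: a_def)
qed

lemma convex_on_tangent_le:
  fixes g g' :: "real \<Rightarrow> real"
  assumes "convex_on UNIV g" and "(g has_real_derivative g' s) (at s)"
  shows "g' s * (r - s) \<le> g r - g s"
  using convex_on_imp_above_tangent[of UNIV g s r "g' s"] assms by simp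

text \<open>Since \<open>1 + \<alpha> < 2\<close>, the quadratic wins beyond a threshold, and below
  it the power is bounded by a constant.\<close>

lemma powr_le_quadratic:
  fixes \<alpha> \<epsilon> :: real
  assumes "\<alpha> < 1" "0 < \<alpha>" "0 < \<epsilon>"
  obtains C where "0 \<le> C" and "\<And>w. 0 \<le> w \<Longrightarrow> w powr (1 + \<alpha>) \<le> \<epsilon> * w\<^sup>2 + C"
proof
  \<comment> \<open>The threshold solves \<open>R powr (\<alpha> - 1) = \<epsilon>\<close>.\<close>
  define R where "R = (1 / \<epsilon>) powr (1 / (1 - \<alpha>))"
  have R: "R > 0" using assms by (simp add: R_def)
  show "0 \<le> R powr (1 + \<alpha>)" by simp
  fix w :: real assume w: "0 \<le> w"
  show "w powr (1 + \<alpha>) \<le> \<epsilon> * w\<^sup>2 + R powr (1 + \<alpha>)"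
  proof (cases "R \<le> w")
    case True
    then have w0: "w > 0" using R by simp
    have "w powr (\<alpha> - 1) \<le> R powr (\<alpha> - 1)"
      using True R assms by (intro powr_mono2') auto
    also have "\<dots> = (1 / \<epsilon>) powr (- 1)"
    proof -
      have "1 / (1 - \<alpha>) * (\<alpha> - 1) = - 1" using assms by (simp add: field_simps)
      then show ?thesis unfolding R_def powr_powr by simp
    qed
    also have "\<dots> = \<epsilon>" using assms by (simp add: powr_minus)
    finally have "w\<^sup>2 * w powr (\<alpha> - 1) \<le> w\<^sup>2 * \<epsilon>" by (intro mult_left_mono) auto
    moreover have "w\<^sup>2 * w powr (\<alpha> - 1) = w powr (1 + \<alpha>)"
    proof -
      have "w\<^sup>2 * w powr (\<alpha> - 1) = w powr 2 * w powr (\<alpha> - 1)" using w0 by simp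
      also have "\<dots> = w powr (2 + (\<alpha> - 1))" by (simp only: powr_add)
      also have "2 + (\<alpha> - 1) = 1 + \<alpha>" by simp
      finally show ?thesis .
    qed
    ultimately have "w powr (1 + \<alpha>) \<le> \<epsilon> * w\<^sup>2" by (simp add: mult.commute)
    then show ?thesis by (simp add: add_increasing2)
  next
    case False
    then have "w powr (1 + \<alpha>) \<le> R powr (1 + \<alpha>)"
      using w assms by (intro powr_mono2) auto
    then show ?thesis using assms by (simp add: add_increasing)
  qed
qed

text \<open>Move from \<open>s\<close> to \<open>r = s - \<tau> * g' s\<close>. The tangent at
  \<open>r\<close> together with \<open>0 \<le> g r\<close> gives
  \<open>g' r * (\<tau> * g' s) \<le> g s\<close>, and the Hoelder condition bounds the error of
  replacing \<open>g' r\<close> by \<open>g' s\<close>.\<close>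

lemma hoelder_descent:
  fixes g g' :: "real \<Rightarrow> real"
  assumes nonneg: "\<And>s. 0 \<le> g s"
    and deriv: "\<And>s. (g has_real_derivative g' s) (at s)"
    and convex: "convex_on UNIV g"
    and hoelder: "\<And>s s'. \<bar>g' s - g' s'\<bar> \<le> L * \<bar>s - s'\<bar> powr \<alpha>"
    and "0 < \<tau>"
  shows "\<tau> * (g' s)\<^sup>2 \<le> g s + L * \<tau> powr (1 + \<alpha>) * \<bar>g' s\<bar> powr (1 + \<alpha>)"
proof (cases "g' s = 0")
  case True
  then show ?thesis using nonneg by simp
next
  case False
  define w where "w = g' s"
  define r where "r = s - \<tau> * w"
  have w: "w \<noteq> 0" using False by (simp add: w_def)
  have "g' r * (s - r) \<le> g s - g r"
    by (rule convex_on_tangent_le[OF convex deriv])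
  then have 1: "g' r * (\<tau> * w) \<le> g s" using nonneg[of r] by (simp add: r_def)
  have "(w - g' r) * (\<tau> * w) \<le> \<bar>w - g' r\<bar> * \<bar>\<tau> * w\<bar>"
    by (metis abs_ge_self abs_mult)
  also have "\<dots> \<le> (L * \<bar>\<tau> * w\<bar> powr \<alpha>) * \<bar>\<tau> * w\<bar>"
    using hoelder[of s r] by (intro mult_right_mono) (auto simp: r_def w_def)
  also have "\<dots> = L * \<bar>\<tau> * w\<bar> powr (1 + \<alpha>)"
    using w \<open>0 < \<tau>\<close> by (simp add: powr_add)
  also have "\<dots> = L * \<tau> powr (1 + \<alpha>) * \<bar>w\<bar> powr (1 + \<alpha>)"
    using \<open>0 < \<tau>\<close> by (simp add: abs_mult powr_mult)
  finally have "w * (\<tau> * w) - g' r * (\<tau> * w) \<le> L * \<tau> powr (1 + \<alpha>) * \<bar>w\<bar> powr (1 + \<alpha>)"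
    by (simp add: left_diff_distrib)
  with 1 have "w * (\<tau> * w) \<le> g s + L * \<tau> powr (1 + \<alpha>) * \<bar>w\<bar> powr (1 + \<alpha>)" by linarith
  then show ?thesis by (simp add: w_def power2_eq_square mult.left_commute)
qed

lemma constA_pos: "0 < \<alpha> \<Longrightarrow> 0 < L \<Longrightarrow> 0 < constA \<alpha> L"
  by (simp add: constA_def)

text \<open>A suitable step length in \<open>hoelder_descent\<close> gives the factor
  \<open>constA\<close>; for \<open>\<alpha> < 1\<close> the power \<open>1 + \<alpha>\<close> is
  absorbed into the square at the price of a constant. \<open>B\<close> is chosen before
  \<open>g\<close>, so one value serves the losses of all labels.\<close>

lemma hoelder_self_bounding:
  fixes \<alpha> L :: real
  assumes \<alpha>: "0 < \<alpha>" "\<alpha> \<le> 1" and L: "0 < L"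
  obtains B where "0 \<le> B"
    and "\<And>g g' s. (\<And>s. 0 \<le> g s) \<Longrightarrow> (\<And>s. (g has_real_derivative g' s) (at s)) \<Longrightarrow>
      convex_on UNIV g \<Longrightarrow> (\<And>s s'. \<bar>g' s - g' s'\<bar> \<le> L * \<bar>s - s'\<bar> powr \<alpha>) \<Longrightarrow>
      (g' s)\<^sup>2 \<le> constA \<alpha> L * g s + B"
proof (cases "\<alpha> = 1")
  case True
  have A: "constA \<alpha> L = 4 * L" using L by (simp add: True constA_def)
  show ?thesis
  proof (rule that[of 0])
    fix g g' :: "real \<Rightarrow> real" and s
    assume *: "\<And>s. 0 \<le> g s" "\<And>s. (g has_real_derivative g' s) (at s)"
      "convex_on UNIV g" "\<And>s s'. \<bar>g' s - g' s'\<bar> \<le> L * \<bar>s - s'\<bar> powr \<alpha>"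
    \<comment> \<open>The step length \<open>1 / (2 * L)\<close> maximizes
      \<open>\<tau> - L * \<tau>\<^sup>2\<close>, with value \<open>1 / (4 * L)\<close>.\<close>
    have "1 / (2 * L) * (g' s)\<^sup>2
        \<le> g s + L * (1 / (2 * L)) powr (1 + \<alpha>) * \<bar>g' s\<bar> powr (1 + \<alpha>)"
      using L by (intro hoelder_descent[OF *]) auto
    also have "\<bar>g' s\<bar> powr (1 + \<alpha>) = (g' s)\<^sup>2"
      by (cases "g' s = 0") (simp_all add: True)
    also have "(1 / (2 * L)) powr (1 + \<alpha>) = (1 / (2 * L))\<^sup>2"
      using L by (simp add: True)
    finally show "(g' s)\<^sup>2 \<le> constA \<alpha> L * g s + 0"
      using L by (simp add: A field_simps power2_eq_square)
  qed simp
next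
  case False
  then have a1: "\<alpha> < 1" using \<alpha> by simp
  define A where "A = constA \<alpha> L"
  have A: "A > 0" unfolding A_def using \<alpha> L by (intro constA_pos)
  define c where "c = L * (2 / A) powr (1 + \<alpha>)"
  have c: "c > 0" using L A by (simp add: c_def)
  \<comment> \<open>After multiplication by \<open>c\<close> the quadratic term is
    \<open>w\<^sup>2 / A\<close>, half of what the step length \<open>2 / A\<close> produces on the
    left-hand side.\<close>
  obtain C where C: "0 \<le> C" "\<And>w. 0 \<le> w \<Longrightarrow> w powr (1 + \<alpha>) \<le> 1 / (A * c) * w\<^sup>2 + C"
    using powr_le_quadratic[OF a1 \<alpha>(1), of "1 / (A * c)"] A c by auto
  show ?thesis
  proof (rule that[of "A * (c * C)"])
    show "0 \<le> A * (c * C)" using A c C by simp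
    fix g g' :: "real \<Rightarrow> real" and s
    assume *: "\<And>s. 0 \<le> g s" "\<And>s. (g has_real_derivative g' s) (at s)"
      "convex_on UNIV g" "\<And>s s'. \<bar>g' s - g' s'\<bar> \<le> L * \<bar>s - s'\<bar> powr \<alpha>"
    have "2 / A * (g' s)\<^sup>2 \<le> g s + c * \<bar>g' s\<bar> powr (1 + \<alpha>)"
      unfolding c_def using A by (intro hoelder_descent[OF *]) auto
    also have "\<dots> \<le> g s + c * (1 / (A * c) * \<bar>g' s\<bar>\<^sup>2 + C)"
      using C(2)[of "\<bar>g' s\<bar>"] c by simp
    also have "\<dots> = g s + 1 / A * (g' s)\<^sup>2 + c * C"
      using c by (simp add: field_simps)
    finally have "1 / A * (g' s)\<^sup>2 \<le> g s + c * C" by (simp add: field_simps)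
    then have "A * (1 / A * (g' s)\<^sup>2) \<le> A * (g s + c * C)" using A by (intro mult_left_mono) auto
    then show "(g' s)\<^sup>2 \<le> constA \<alpha> L * g s + A * (c * C)"
      using A by (simp add: A_def[symmetric] algebra_simps)
  qed
qed

section \<open>Online gradient descent with a self-bounding loss\<close>

lemma ogd_Suc:
  "1 \<le> t \<Longrightarrow> ogd kx dphi eta z (Suc t) = ogd kx dphi eta z t
     - (eta t * dphi (snd (z t)) (inner (ogd kx dphi eta z t) (kx (fst (z t))))) *\<^sub>R kx (fst (z t))"
  by (cases t) auto

text \<open>This plays the role of adaptedness: sample \<open>t\<close> can be integrated out while
  the iterate \<open>t\<close> stays fixed.\<close>

lemma ogd_cong:
  "(\<And>i. 1 \<le> i \<Longrightarrow> i < t \<Longrightarrow> z i = z' i) \<Longrightarrow> ogd kx dphi eta z t = ogd kx dphi eta z' t"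
proof (induction t)
  case (Suc t)
  then show ?case by (cases "t = 0") (auto simp: ogd_Suc)
qed simp

text \<open>The Hoelder condition is replaced by its consequence \<open>self_bounding\<close>.
  \<open>M\<close> bounds both the loss at 0 and the loss of \<open>fH\<close>, and
  \<open>\<kappa>\<close> may be any bound on the feature norms that satisfies the step size
  condition.\<close>

locale self_bounding_ogd = prob_space \<rho>
  for \<rho> :: "('a::euclidean_space \<times> real) measure" +
  fixes X :: "'a set" and Y :: "real set"
    and kx :: "'a \<Rightarrow> 'h::real_inner"
    and phi dphi :: "real \<Rightarrow> real \<Rightarrow> real"
    and A B \<kappa> M :: real and eta :: "nat \<Rightarrow> real" and fH :: 'h
  assumes rho_sets: "sets \<rho> = sets (restrict_space borel (X \<times> Y))"
    and K_cont: "continuous_on (X \<times> X) (\<lambda>(x, x'). kern kx x x')"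
    and norm_kx: "\<And>x. x \<in> X \<Longrightarrow> norm (kx x) \<le> \<kappa>"
    and phi_nonneg: "\<And>y s. y \<in> Y \<Longrightarrow> phi y s \<ge> 0"
    and phi_meas: "(\<lambda>(y, s). phi y s) \<in> borel_measurable (restrict_space borel (Y \<times> UNIV))"
    and phi_deriv: "\<And>y s. y \<in> Y \<Longrightarrow> (phi y has_real_derivative dphi y s) (at s)"
    and phi_convex: "\<And>y. y \<in> Y \<Longrightarrow> convex_on UNIV (phi y)"
    and self_bounding: "\<And>y s. y \<in> Y \<Longrightarrow> (dphi y s)\<^sup>2 \<le> A * phi y s + B"
    and A_pos: "0 < A" and B_nonneg: "0 \<le> B"
    and fH_min: "\<And>f. gen_err \<rho> phi (evalf kx fH) \<le> gen_err \<rho> phi (evalf kx f)"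
    and phi_0_le: "\<And>y. y \<in> Y \<Longrightarrow> phi y 0 \<le> M"
    and phi_fH_le: "\<And>x y. x \<in> X \<Longrightarrow> y \<in> Y \<Longrightarrow> phi y (inner fH (kx x)) \<le> M"
    and eta_pos: "\<And>t. t \<ge> 1 \<Longrightarrow> eta t > 0"
    and eta_le: "\<And>t. t \<ge> 1 \<Longrightarrow> eta t * (A * \<kappa>\<^sup>2) \<le> 1"
    and eta_mono: "\<And>t. t \<ge> 1 \<Longrightarrow> eta (Suc t) \<le> eta t"
    and eta_sq: "summable (\<lambda>t. (eta t)\<^sup>2)"
begin

abbreviation risk :: "'h \<Rightarrow> real" where
  "risk f \<equiv> gen_err \<rho> phi (evalf kx f)"

definition loss :: "'h \<Rightarrow> 'a \<times> real \<Rightarrow> real" where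
  "loss f p = phi (snd p) (inner f (kx (fst p)))"

definition excess :: "'h \<Rightarrow> 'a \<times> real \<Rightarrow> real" where
  "excess f p = loss f p - loss fH p"

definition iter :: "(nat \<Rightarrow> 'a \<times> real) \<Rightarrow> nat \<Rightarrow> 'h" where
  "iter z t = ogd kx dphi eta z t"

definition dist2 :: "'h \<Rightarrow> real" where
  "dist2 f = (norm (f - fH))\<^sup>2"

text \<open>Serves as an upper bound for partial sums over indices from 1 on, so the extra term of
  index 0 does no harm.\<close>

definition S2 :: real where
  "S2 = (\<Sum>t. (eta t)\<^sup>2)"

lemma space_rho: "space \<rho> = X \<times> Y"
  using sets_eq_imp_space_eq[OF rho_sets] by (simp add: space_restrict_space)

lemma fst_snd_mem: "p \<in> space \<rho> \<Longrightarrow> fst p \<in> X \<and> snd p \<in> Y"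
  by (auto simp: space_rho)

lemma M_nonneg: "0 \<le> M"
proof -
  obtain p where "p \<in> space \<rho>" using not_empty by auto
  then have "snd p \<in> Y" using fst_snd_mem by auto
  then show "0 \<le> M" using phi_0_le phi_nonneg order_trans by blast
qed

lemma loss_nonneg: "p \<in> space \<rho> \<Longrightarrow> 0 \<le> loss f p"
  unfolding loss_def using fst_snd_mem phi_nonneg by blast

lemma loss_fH_le: "p \<in> space \<rho> \<Longrightarrow> loss fH p \<le> M"
  unfolding loss_def using fst_snd_mem phi_fH_le by blast

lemma risk_eq: "risk f = (\<integral>p. loss f p \<partial>\<rho>)"
  by (simp add: gen_err_def evalf_def loss_def)

subsection \<open>Measurability\<close>

lemma rho_measurable_borel: "b \<in> measurable N \<rho> \<Longrightarrow> b \<in> borel_measurable N"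
proof -
  have "(\<lambda>p. p) \<in> measurable (restrict_space borel (X \<times> Y)) borel"
    by (intro measurable_restrict_space1) simp
  then have "(\<lambda>p. p) \<in> measurable \<rho> borel"
    using measurable_cong_sets[OF rho_sets refl] by blast
  then show "b \<in> measurable N \<rho> \<Longrightarrow> b \<in> borel_measurable N"
    using measurable_compose by blast
qed

lemma
  assumes b: "b \<in> measurable N \<rho>"
  shows measurable_fst_rho: "(\<lambda>w. fst (b w)) \<in> borel_measurable N"
    and measurable_snd_rho: "(\<lambda>w. snd (b w)) \<in> borel_measurable N"
    and fst_rho_mem: "w \<in> space N \<Longrightarrow> fst (b w) \<in> X"
    and snd_rho_mem: "w \<in> space N \<Longrightarrow> snd (b w) \<in> Y"
proof -
  have b': "b \<in> measurable N (borel \<Otimes>\<^sub>M borel)"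
    using rho_measurable_borel[OF b] by (simp add: borel_prod)
  show "(\<lambda>w. fst (b w)) \<in> borel_measurable N" "(\<lambda>w. snd (b w)) \<in> borel_measurable N"
    using b' by measurable
  show "w \<in> space N \<Longrightarrow> fst (b w) \<in> X" "w \<in> space N \<Longrightarrow> snd (b w) \<in> Y"
    using measurable_space[OF b] fst_snd_mem by blast+
qed

lemma measurable_kernel:
  assumes a: "a \<in> measurable N \<rho>" and b: "b \<in> measurable N \<rho>"
  shows "(\<lambda>w. inner (kx (fst (a w))) (kx (fst (b w)))) \<in> borel_measurable N"
proof -
  have "(\<lambda>w. (fst (a w), fst (b w))) \<in> measurable N (restrict_space borel (X \<times> X))"
    using a b by (intro measurable_restrict_space2 borel_measurable_Pair)
      (auto intro: measurable_fst_rho fst_rho_mem)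
  from measurable_compose[OF this borel_measurable_continuous_on_restrict[OF K_cont]]
  show ?thesis by (simp add: kern_def)
qed

lemma measurable_phi:
  assumes b: "b \<in> measurable N \<rho>" and c: "c \<in> borel_measurable N"
  shows "(\<lambda>w. phi (snd (b w)) (c w)) \<in> borel_measurable N"
proof -
  have "(\<lambda>w. (snd (b w), c w)) \<in> measurable N (restrict_space borel (Y \<times> UNIV))"
    using b c by (intro measurable_restrict_space2 borel_measurable_Pair)
      (auto intro: measurable_snd_rho snd_rho_mem)
  from measurable_compose[OF this phi_meas] show ?thesis by simp
qed

text \<open>Measurability passes from \<open>phi\<close> to its derivative as a pointwise limit of
  difference quotients with increments \<open>1 / real (Suc n)\<close>.\<close>

lemma measurable_dphi:
  assumes b: "b \<in> measurable N \<rho>" and c: "c \<in> borel_measurable N"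
  shows "(\<lambda>w. dphi (snd (b w)) (c w)) \<in> borel_measurable N"
proof (rule borel_measurable_LIMSEQ_real)
  let ?h = "\<lambda>n::nat. 1 / real (Suc n)"
  fix w assume w: "w \<in> space N"
  have "(phi (snd (b w)) has_real_derivative dphi (snd (b w)) (c w)) (at (c w))"
    using phi_deriv snd_rho_mem[OF b w] by blast
  then have "(\<lambda>h. (phi (snd (b w)) (c w + h) - phi (snd (b w)) (c w)) / h)
      \<midarrow>0\<rightarrow> dphi (snd (b w)) (c w)"
    by (simp add: DERIV_def)
  moreover have "filterlim ?h (at 0) sequentially"
    using LIMSEQ_inverse_real_of_nat by (auto simp: filterlim_at inverse_eq_divide)
  ultimately show "(\<lambda>n. (phi (snd (b w)) (c w + ?h n) - phi (snd (b w)) (c w)) / ?h n)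
      \<longlonglongrightarrow> dphi (snd (b w)) (c w)"
    by (rule filterlim_compose)
next
  fix n
  show "(\<lambda>w. (phi (snd (b w)) (c w + 1 / real (Suc n)) - phi (snd (b w)) (c w)) / (1 / real (Suc n)))
      \<in> borel_measurable N"
    using b c by (intro borel_measurable_divide borel_measurable_diff measurable_phi) auto
qed

text \<open>The squared norm of \<open>kx x - kx a\<close> expands into kernel values, which are
  continuous in \<open>x\<close>.\<close>

lemma continuous_on_kx: "continuous_on X kx"
proof (unfold continuous_on_def, rule ballI)
  fix a assume a: "a \<in> X"
  have "continuous_on X (\<lambda>x. case (x, x) of (x, x') \<Rightarrow> kern kx x x')"
    "continuous_on X (\<lambda>x. case (x, a) of (x, x') \<Rightarrow> kern kx x x')"
    using a by (intro continuous_on_compose2[OF K_cont] continuous_intros; auto)+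
  then have "continuous_on X (\<lambda>x. inner (kx x) (kx x) - 2 * inner (kx x) (kx a) + inner (kx a) (kx a))"
    unfolding kern_def prod.case
    by (intro continuous_on_add continuous_on_diff continuous_on_mult continuous_on_const)
  then have "((\<lambda>x. inner (kx x) (kx x) - 2 * inner (kx x) (kx a) + inner (kx a) (kx a))
      \<longlongrightarrow> inner (kx a) (kx a) - 2 * inner (kx a) (kx a) + inner (kx a) (kx a)) (at a within X)"
    using a unfolding continuous_on_def by blast
  then have "((\<lambda>x. (norm (kx x - kx a))\<^sup>2) \<longlongrightarrow> 0) (at a within X)"
    by (simp add: power2_norm_eq_inner inner_diff_left inner_diff_right inner_commute algebra_simps)
  from tendsto_real_sqrt[OF this] have "((\<lambda>x. norm (kx x - kx a)) \<longlongrightarrow> 0) (at a within X)"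
    by simp
  then show "(kx \<longlongrightarrow> kx a) (at a within X)"
    unfolding tendsto_dist_iff[of kx "kx a"] dist_norm .
qed

lemma measurable_inner_kx:
  assumes b: "b \<in> measurable N \<rho>"
  shows "(\<lambda>w. inner f (kx (fst (b w)))) \<in> borel_measurable N"
proof -
  have "(\<lambda>x. inner f (kx x)) \<in> borel_measurable (restrict_space borel X)"
    by (intro borel_measurable_continuous_on_restrict continuous_intros continuous_on_kx)
  moreover have "(\<lambda>w. fst (b w)) \<in> measurable N (restrict_space borel X)"
    using b by (intro measurable_restrict_space2) (auto intro: measurable_fst_rho fst_rho_mem)
  ultimately show ?thesis using measurable_compose by blast
qed

lemma measurable_loss [measurable]: "loss f \<in> borel_measurable \<rho>"
  unfolding loss_def by (intro measurable_phi measurable_inner_kx) auto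

text \<open>The iterates are never treated as random elements of \<open>'h\<close>, which need not
  be second countable; only their real evaluations are. The induction is general in \<open>b\<close>
  because the recursion evaluates the previous iterate both at \<open>b\<close> and at sample
  \<open>t\<close>.\<close>

lemma measurable_inner_iter:
  assumes "\<And>i. 1 \<le> i \<Longrightarrow> i < t \<Longrightarrow> (\<lambda>w. a w i) \<in> measurable N \<rho>" and "b \<in> measurable N \<rho>"
  shows "(\<lambda>w. inner (iter (a w) t) (kx (fst (b w)))) \<in> borel_measurable N"
  using assms
proof (induction t arbitrary: b)
  case 0
  then show ?case by (simp add: iter_def)
next
  case (Suc t)
  show ?case
  proof (cases "t = 0")
    case True
    then show ?thesis by (simp add: iter_def)
  next
    case False
    then have t: "1 \<le> t" by simp
    have at: "(\<lambda>w. a w t) \<in> measurable N \<rho>" using Suc.prems(1) t by simp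
    have IH: "(\<lambda>w. inner (iter (a w) t) (kx (fst (b w)))) \<in> borel_measurable N"
      if "b \<in> measurable N \<rho>" for b
      using Suc that by simp
    show ?thesis
      unfolding iter_def ogd_Suc[OF t] inner_diff_left inner_scaleR_left
      by (fold iter_def, intro borel_measurable_diff borel_measurable_times borel_measurable_const
          IH Suc.prems(2) at measurable_dphi measurable_kernel)
  qed
qed

lemma measurable_loss_iter:
  assumes "\<And>i. 1 \<le> i \<Longrightarrow> i < t \<Longrightarrow> (\<lambda>w. a w i) \<in> measurable N \<rho>" and "b \<in> measurable N \<rho>"
  shows "(\<lambda>w. loss (iter (a w) t) (b w)) \<in> borel_measurable N"
  unfolding loss_def using assms by (intro measurable_phi measurable_inner_iter)

lemma measurable_excess_iter:
  assumes "\<And>i. 1 \<le> i \<Longrightarrow> i < t \<Longrightarrow> (\<lambda>w. a w i) \<in> measurable N \<rho>" and "b \<in> measurable N \<rho>"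
  shows "(\<lambda>w. excess (iter (a w) t) (b w)) \<in> borel_measurable N"
  unfolding excess_def
  by (intro borel_measurable_diff measurable_loss_iter[OF assms] measurable_compose[OF assms(2) measurable_loss])

text \<open>The risk integrates, over a fresh sample, a loss that is jointly measurable in the past
  and that sample.\<close>

lemma measurable_risk_iter:
  assumes "\<And>i. 1 \<le> i \<Longrightarrow> i < t \<Longrightarrow> (\<lambda>w. a w i) \<in> measurable N \<rho>"
  shows "(\<lambda>w. risk (iter (a w) t)) \<in> borel_measurable N"
proof -
  have "(\<lambda>q. loss (iter (a (fst q)) t) (snd q)) \<in> borel_measurable (N \<Otimes>\<^sub>M \<rho>)"
    using assms by (intro measurable_loss_iter) (auto intro: measurable_compose[OF measurable_fst])
  then show ?thesis
    unfolding risk_eq by (intro borel_measurable_lebesgue_integral) (simp add: case_prod_beta')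
qed

subsection \<open>Pointwise bounds on the loss\<close>

lemma tangent_le: "y \<in> Y \<Longrightarrow> dphi y s * (r - s) \<le> phi y r - phi y s"
  by (rule convex_on_tangent_le[OF phi_convex phi_deriv])

lemma evaluation_bound:
  assumes "p \<in> space \<rho>"
  shows "\<bar>inner f (kx (fst p))\<bar> \<le> norm f * \<kappa>"
proof -
  have "\<bar>inner f (kx (fst p))\<bar> \<le> norm f * norm (kx (fst p))"
    by (rule Cauchy_Schwarz_ineq2)
  also have "\<dots> \<le> norm f * \<kappa>"
    using assms fst_snd_mem by (intro mult_left_mono norm_kx) auto
  finally show ?thesis .
qed

text \<open>For fixed \<open>f\<close> the loss is bounded, hence integrable. Convexity compares it
  with the loss at 0, and the slope that appears is itself controlled by the loss.\<close>

lemma loss_le: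
  assumes p: "p \<in> space \<rho>"
  shows "loss f p \<le> 2 * M + B / A + A * (norm f * \<kappa>)\<^sup>2"
proof -
  define s y where "s = inner f (kx (fst p))" and "y = snd p"
  have y: "y \<in> Y" using p fst_snd_mem by (simp add: y_def)
  have "phi y s \<le> phi y 0 + dphi y s * s" using tangent_le[OF y, of s 0] by simp
  \<comment> \<open>Young's inequality, weighted so that the self-bounding property turns the slope
    term into half the loss plus a constant; that half is then moved to the left-hand side.\<close>
  also have "dphi y s * s \<le> (dphi y s)\<^sup>2 / (2 * A) + A * s\<^sup>2 / 2"
  proof -
    have "0 \<le> (dphi y s - A * s)\<^sup>2 / (2 * A)" using A_pos by simp
    also have "\<dots> = (dphi y s)\<^sup>2 / (2 * A) + A * s\<^sup>2 / 2 - dphi y s * s"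
      using A_pos by (simp add: field_simps power2_eq_square)
    finally show ?thesis by simp
  qed
  also have "(dphi y s)\<^sup>2 / (2 * A) \<le> (A * phi y s + B) / (2 * A)"
    using self_bounding[OF y] A_pos by (intro divide_right_mono) auto
  also have "\<dots> = phi y s / 2 + B / A / 2" using A_pos by (simp add: field_simps)
  finally have "phi y s \<le> 2 * phi y 0 + B / A + A * s\<^sup>2" by simp
  moreover have "A * s\<^sup>2 \<le> A * (norm f * \<kappa>)\<^sup>2"
    using evaluation_bound[OF p, of f] A_pos unfolding s_def
    by (metis abs_ge_zero less_imp_le mult_left_mono power2_abs power_mono)
  ultimately show ?thesis using phi_0_le[OF y] by (simp add: loss_def s_def y_def)
qed

lemma integrable_loss: "integrable \<rho> (loss f)"
  using loss_le loss_nonneg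
  by (intro integrable_const_bound[of _ "2 * M + B / A + A * (norm f * \<kappa>)\<^sup>2"]) auto

lemma integral_excess: "(\<integral>p. excess f p \<partial>\<rho>) = risk f - risk fH"
  unfolding excess_def risk_eq by (intro Bochner_Integration.integral_diff integrable_loss)

lemma risk_fH_le: "risk fH \<le> M"
  unfolding risk_eq
  by (rule order_trans[OF integral_mono[OF integrable_loss integrable_const[of M]]])
    (auto simp: loss_fH_le prob_space)

text \<open>Convexity traps the difference of the losses between the tangent increments at its two
  end points. The self-bounding property turns the squared slopes back into losses, and
  Cauchy-Schwarz bounds the squared displacement.\<close>

lemma excess_sq_le:
  assumes p: "p \<in> space \<rho>"
  shows "(excess f p)\<^sup>2 \<le> \<kappa>\<^sup>2 * dist2 f * (A * loss f p + A * loss fH p + 2 * B)"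
proof -
  define s r y where "s = inner f (kx (fst p))" and "r = inner fH (kx (fst p))" and "y = snd p"
  have y: "y \<in> Y" using p fst_snd_mem by (simp add: y_def)
  define d where "d = phi y s - phi y r"
  have up: "d \<le> dphi y s * (s - r)"
    using tangent_le[OF y, of s r] by (simp add: d_def algebra_simps)
  have lo: "dphi y r * (s - r) \<le> d"
    using tangent_le[OF y, of r s] by (simp add: d_def)
  have "d\<^sup>2 \<le> (dphi y s * (s - r))\<^sup>2 + (dphi y r * (s - r))\<^sup>2"
  proof (cases "0 \<le> d")
    case True
    then have "d\<^sup>2 \<le> (dphi y s * (s - r))\<^sup>2" using up by (intro power_mono)
    then show ?thesis by (simp add: add_increasing2)
  next
    case False
    then have "(- d)\<^sup>2 \<le> (- (dphi y r * (s - r)))\<^sup>2" using lo by (intro power_mono) auto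
    then show ?thesis by (simp add: add_increasing)
  qed
  also have "\<dots> = ((dphi y s)\<^sup>2 + (dphi y r)\<^sup>2) * (s - r)\<^sup>2"
    by (simp only: power_mult_distrib distrib_right)
  also have "\<dots> \<le> (A * phi y s + A * phi y r + 2 * B) * (\<kappa>\<^sup>2 * dist2 f)"
  proof (rule mult_mono)
    show "(dphi y s)\<^sup>2 + (dphi y r)\<^sup>2 \<le> A * phi y s + A * phi y r + 2 * B"
      using self_bounding[OF y, of s] self_bounding[OF y, of r] by simp
    show "(s - r)\<^sup>2 \<le> \<kappa>\<^sup>2 * dist2 f"
    proof -
      have "\<bar>s - r\<bar> \<le> norm (f - fH) * \<kappa>"
        using evaluation_bound[OF p, of "f - fH"] by (simp add: s_def r_def inner_diff_left)
      then have "(s - r)\<^sup>2 \<le> (norm (f - fH) * \<kappa>)\<^sup>2" by (metis abs_ge_zero power2_abs power_mono)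
      then show ?thesis by (simp add: dist2_def power_mult_distrib mult.commute)
    qed
    show "0 \<le> A * phi y s + A * phi y r + 2 * B" using phi_nonneg[OF y] A_pos B_nonneg by simp
  qed simp
  finally show ?thesis
    by (simp add: excess_def loss_def d_def s_def r_def y_def mult.commute)
qed

lemma excess_ge: "p \<in> space \<rho> \<Longrightarrow> - M \<le> excess f p"
  using loss_nonneg[of p f] loss_fH_le[of p] by (simp add: excess_def)

subsection \<open>Deterministic bounds along the iteration\<close>

lemma dist2_nonneg: "0 \<le> dist2 f"
  by (simp add: dist2_def)

text \<open>Expand the squared norm: convexity handles the cross term and the self-bounding property
  the squared gradient.\<close>

lemma dist2_step:
  assumes t: "1 \<le> t" and p: "z t \<in> space \<rho>"
  shows "dist2 (iter z (Suc t)) \<le> dist2 (iter z t) - 2 * eta t * excess (iter z t) (z t)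
           + (eta t)\<^sup>2 * \<kappa>\<^sup>2 * (A * loss (iter z t) (z t) + B)"
proof -
  define f x y where "f = iter z t" and "x = fst (z t)" and "y = snd (z t)"
  have x: "x \<in> X" and y: "y \<in> Y" using p fst_snd_mem by (auto simp: x_def y_def)
  define s r where "s = inner f (kx x)" and "r = inner fH (kx x)"
  define g where "g = dphi y s"
  have "iter z (Suc t) - fH = (f - fH) - (eta t * g) *\<^sub>R kx x"
    by (simp add: iter_def ogd_Suc[OF t] f_def x_def y_def s_def g_def)
  moreover have "(norm (v - a *\<^sub>R k))\<^sup>2 = (norm v)\<^sup>2 - 2 * a * inner v k + a\<^sup>2 * (norm k)\<^sup>2"
    for v k :: 'h and a
    by (simp add: power2_norm_eq_inner inner_diff_left inner_diff_right inner_commute[of k v])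
      (simp add: power2_eq_square right_diff_distrib)
  moreover have "inner (f - fH) (kx x) = s - r"
    by (simp add: s_def r_def inner_diff_left)
  ultimately have "dist2 (iter z (Suc t))
      = dist2 f - 2 * (eta t * g) * (s - r) + (eta t * g)\<^sup>2 * (norm (kx x))\<^sup>2"
    by (simp only: dist2_def)
  moreover have "2 * eta t * (phi y s - phi y r) \<le> 2 * (eta t * g) * (s - r)"
  proof -
    have "phi y s - phi y r \<le> g * (s - r)"
      using tangent_le[OF y, of s r] unfolding g_def by (simp add: algebra_simps)
    then show ?thesis using eta_pos[OF t] by (simp add: mult.assoc)
  qed
  moreover have "(eta t * g)\<^sup>2 * (norm (kx x))\<^sup>2 \<le> (eta t)\<^sup>2 * \<kappa>\<^sup>2 * (A * phi y s + B)"
  proof -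
    have "(eta t * g)\<^sup>2 * (norm (kx x))\<^sup>2 = (eta t)\<^sup>2 * ((norm (kx x))\<^sup>2 * g\<^sup>2)"
      by (simp add: power_mult_distrib mult_ac)
    also have "\<dots> \<le> (eta t)\<^sup>2 * (\<kappa>\<^sup>2 * (A * phi y s + B))"
      using norm_kx[OF x] self_bounding[OF y, of s] unfolding g_def
      by (intro mult_left_mono mult_mono power_mono) auto
    finally show ?thesis by (simp add: mult_ac)
  qed
  ultimately have "dist2 (iter z (Suc t)) \<le> dist2 f - 2 * eta t * (phi y s - phi y r)
      + (eta t)\<^sup>2 * \<kappa>\<^sup>2 * (A * phi y s + B)"
    by linarith
  then show ?thesis
    by (simp add: excess_def loss_def f_def x_def y_def s_def r_def)
qed

text \<open>\<open>2 * M\<close> pays for the loss of \<open>fH\<close>, and the other summand for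
  the constant part of the squared gradient, with \<open>eta t \<le> eta 1\<close>.\<close>

definition c1 :: real where
  "c1 = 2 * M + eta 1 * \<kappa>\<^sup>2 * B"

definition c2 :: real where
  "c2 = eta 1 * dist2 0 + c1 * S2"

lemma eta_1_pos: "0 < eta 1"
  using eta_pos by simp

lemma eta_le_1: "1 \<le> t \<Longrightarrow> eta t \<le> eta 1"
  by (induction t rule: dec_induct) (use eta_mono order_trans in \<open>auto\<close>)

lemma sum_eta_sq_le: "(\<Sum>k\<in>{1..<t}. (eta k)\<^sup>2) \<le> S2"
  unfolding S2_def by (intro sum_le_suminf eta_sq) auto

lemma S2_nonneg: "0 \<le> S2"
  unfolding S2_def by (intro suminf_nonneg eta_sq) auto

lemma c1_nonneg: "0 \<le> c1"
  using M_nonneg B_nonneg eta_1_pos by (simp add: c1_def)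

lemma c2_nonneg: "0 \<le> c2"
  using c1_nonneg S2_nonneg eta_1_pos dist2_nonneg by (simp add: c2_def)

text \<open>By the step size condition the squared gradient costs at most one of the two copies of
  \<open>eta t * loss\<close>, so one negative copy survives.\<close>

lemma dist2_step_crude:
  assumes t: "1 \<le> t" and p: "z t \<in> space \<rho>"
  shows "dist2 (iter z (Suc t)) \<le> dist2 (iter z t) - eta t * loss (iter z t) (z t) + c1 * eta t"
proof -
  define l where "l = loss (iter z t) (z t)"
  have l: "0 \<le> l" using loss_nonneg[OF p] by (simp add: l_def)
  have e: "0 < eta t" using eta_pos[OF t] .
  have "eta t * l * (eta t * (A * \<kappa>\<^sup>2)) \<le> eta t * l * 1"
    using eta_le[OF t] e l by (intro mult_left_mono) auto
  moreover have "eta t * (eta t * (\<kappa>\<^sup>2 * B)) \<le> eta t * (eta 1 * (\<kappa>\<^sup>2 * B))"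
    using eta_le_1[OF t] e B_nonneg by (intro mult_left_mono mult_right_mono) auto
  moreover have "eta t * loss fH (z t) \<le> eta t * M"
    using loss_fH_le[OF p] e by simp
  ultimately show ?thesis
    using dist2_step[of t z, OF t p] unfolding excess_def c1_def l_def[symmetric]
    by (simp add: algebra_simps power2_eq_square)
qed

text \<open>Monotonicity of the step sizes makes the weighted distances telescope.\<close>

lemma weighted_dist2_le:
  assumes "1 \<le> t" and "\<And>k. 1 \<le> k \<Longrightarrow> k < t \<Longrightarrow> z k \<in> space \<rho>"
  shows "eta t * dist2 (iter z t) + (\<Sum>k\<in>{1..<t}. (eta k)\<^sup>2 * loss (iter z k) (z k)) \<le> c2"
proof -
  have "eta t * dist2 (iter z t) + (\<Sum>k\<in>{1..<t}. (eta k)\<^sup>2 * loss (iter z k) (z k))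
      \<le> eta 1 * dist2 0 + c1 * (\<Sum>k\<in>{1..<t}. (eta k)\<^sup>2)"
    using assms
  proof (induction t rule: dec_induct)
    case base
    then show ?case by (simp add: iter_def)
  next
    case (step t)
    have p: "z t \<in> space \<rho>" using step by simp
    have "eta (Suc t) * dist2 (iter z (Suc t)) \<le> eta t * dist2 (iter z (Suc t))"
      using eta_mono[OF step(1)] dist2_nonneg by (intro mult_right_mono)
    also have "\<dots> \<le> eta t * (dist2 (iter z t) - eta t * loss (iter z t) (z t) + c1 * eta t)"
      using dist2_step_crude[of t z, OF step(1) p] eta_pos[OF step(1)] by (intro mult_left_mono) auto
    finally have "eta (Suc t) * dist2 (iter z (Suc t)) + (eta t)\<^sup>2 * loss (iter z t) (z t)
        \<le> eta t * dist2 (iter z t) + c1 * (eta t)\<^sup>2"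
      by (simp add: algebra_simps power2_eq_square)
    moreover have "eta t * dist2 (iter z t) + (\<Sum>k\<in>{1..<t}. (eta k)\<^sup>2 * loss (iter z k) (z k))
      \<le> eta 1 * dist2 0 + c1 * (\<Sum>k\<in>{1..<t}. (eta k)\<^sup>2)"
      using step by simp
    ultimately show ?case using step(1) by (simp add: algebra_simps)
  qed
  also have "\<dots> \<le> c2" unfolding c2_def using sum_eta_sq_le c1_nonneg by (simp add: mult_left_mono)
  finally show ?thesis .
qed

lemma eta_dist2_le:
  assumes "1 \<le> t" and "\<And>k. 1 \<le> k \<Longrightarrow> k < t \<Longrightarrow> z k \<in> space \<rho>"
  shows "eta t * dist2 (iter z t) \<le> c2"
proof -
  have "0 \<le> (\<Sum>k\<in>{1..<t}. (eta k)\<^sup>2 * loss (iter z k) (z k))"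
    using assms(2) loss_nonneg by (intro sum_nonneg mult_nonneg_nonneg) auto
  then show ?thesis using weighted_dist2_le[of t z, OF assms] by simp
qed

text \<open>Initial distance plus the total contribution of the squared gradients, after the
  weighted losses are bounded by \<open>c2\<close>.\<close>

definition C0 :: real where
  "C0 = dist2 0 + \<kappa>\<^sup>2 * (A * c2 + B * S2)"

text \<open>A majorant of the squared distance whose increments are exactly linear in the excess
  loss, so that its exponential can be integrated one sample at a time.\<close>

definition Q :: "(nat \<Rightarrow> 'a \<times> real) \<Rightarrow> nat \<Rightarrow> real" where
  "Q z t = C0 - 2 * (\<Sum>k\<in>{1..<t}. eta k * excess (iter z k) (z k))"

lemma C0_nonneg: "0 \<le> C0"
  using dist2_nonneg A_pos c2_nonneg B_nonneg S2_nonneg by (simp add: C0_def)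

lemma Q_Suc: "1 \<le> t \<Longrightarrow> Q z (Suc t) = Q z t - 2 * eta t * excess (iter z t) (z t)"
  by (simp add: Q_def algebra_simps)

text \<open>Summing \<open>dist2_step\<close> leaves a weighted sum of losses, which
  \<open>weighted_dist2_le\<close> bounds by \<open>c2\<close> on every sample path.\<close>

lemma dist2_le_Q:
  assumes "1 \<le> t" and "\<And>k. 1 \<le> k \<Longrightarrow> k < t \<Longrightarrow> z k \<in> space \<rho>"
  shows "dist2 (iter z t) \<le> Q z t"
proof -
  have "dist2 (iter z t) \<le> dist2 0 - 2 * (\<Sum>k\<in>{1..<t}. eta k * excess (iter z k) (z k))
      + \<kappa>\<^sup>2 * (A * (\<Sum>k\<in>{1..<t}. (eta k)\<^sup>2 * loss (iter z k) (z k)) + B * (\<Sum>k\<in>{1..<t}. (eta k)\<^sup>2))"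
    using assms
  proof (induction t rule: dec_induct)
    case base
    then show ?case by (simp add: iter_def)
  next
    case (step t)
    then show ?case using dist2_step[of t z] by (simp add: algebra_simps)
  qed
  also have "\<dots> \<le> Q z t"
  proof -
    have "0 \<le> eta t * dist2 (iter z t)"
      using eta_pos[OF assms(1)] dist2_nonneg by simp
    then have "(\<Sum>k\<in>{1..<t}. (eta k)\<^sup>2 * loss (iter z k) (z k)) \<le> c2"
      using weighted_dist2_le[of t z, OF assms] by linarith
    then have "\<kappa>\<^sup>2 * (A * (\<Sum>k\<in>{1..<t}. (eta k)\<^sup>2 * loss (iter z k) (z k)) + B * (\<Sum>k\<in>{1..<t}. (eta k)\<^sup>2))
       \<le> \<kappa>\<^sup>2 * (A * c2 + B * S2)"
      using A_pos B_nonneg sum_eta_sq_le by (intro mult_left_mono add_mono) auto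
    then show ?thesis by (simp add: Q_def C0_def)
  qed
  finally show ?thesis .
qed

subsection \<open>The exponential moment\<close>

definition c3 :: real where
  "c3 = 4 * \<kappa>\<^sup>2 * (2 * A * M + 2 * B)"

lemma c3_nonneg: "0 \<le> c3"
  using A_pos M_nonneg B_nonneg by (simp add: c3_def)

text \<open>Integrate the quadratic bound for the exponential. The second moment contains the excess
  risk once more, but \<open>D\<close> and \<open>ec\<close> make that part at most half of the
  linear term; the rest is a multiple of \<open>dist2 f\<close>.\<close>

lemma exp_excess_le:
  assumes e: "0 \<le> e" and h: "0 \<le> h" and hM: "2 * e * h * M \<le> 1"
    and D: "h * dist2 f \<le> c2" and ec: "4 * e * \<kappa>\<^sup>2 * A * c2 \<le> 1"
  shows "(\<integral>\<^sup>+p. ennreal (exp (- (2 * e * h * excess f p))) \<partial>\<rho>)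
      \<le> ennreal (exp (- (e * h * (risk f - risk fH)) + c3 * e\<^sup>2 * h\<^sup>2 * dist2 f))"
proof -
  define G where "G = risk f - risk fH"
  have G: "0 \<le> G" using fH_min by (simp add: G_def)
  define q where "q = 4 * e\<^sup>2 * h\<^sup>2 * (\<kappa>\<^sup>2 * dist2 f)"
  have q: "0 \<le> q" using dist2_nonneg by (simp add: q_def)
  define u where "u p = 1 - 2 * e * h * excess f p + q * (A * loss f p + A * loss fH p + 2 * B)" for p
  have u: "exp (- (2 * e * h * excess f p)) \<le> u p" if p: "p \<in> space \<rho>" for p
  proof -
    have "2 * e * h * (- excess f p) \<le> 2 * e * h * M"
      using excess_ge[OF p, of f] e h by (intro mult_left_mono) auto
    then have "- (2 * e * h * excess f p) \<le> 1"
      using hM unfolding mult_minus_right by (rule order_trans)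
    from exp_le_quadratic[OF this]
    have "exp (- (2 * e * h * excess f p)) \<le> 1 - 2 * e * h * excess f p + (2 * e * h)\<^sup>2 * (excess f p)\<^sup>2"
      by (simp add: power_mult_distrib)
    also have "(2 * e * h)\<^sup>2 * (excess f p)\<^sup>2
        \<le> (2 * e * h)\<^sup>2 * (\<kappa>\<^sup>2 * dist2 f * (A * loss f p + A * loss fH p + 2 * B))"
      using excess_sq_le[OF p] by (intro mult_left_mono) auto
    finally show ?thesis by (simp add: u_def q_def power_mult_distrib mult_ac)
  qed
  have int_excess: "integrable \<rho> (excess f)"
    unfolding excess_def by (intro Bochner_Integration.integrable_diff integrable_loss)
  have int_u: "integrable \<rho> u"
    unfolding u_def using integrable_loss int_excess by auto
  have "(\<integral>\<^sup>+p. ennreal (exp (- (2 * e * h * excess f p))) \<partial>\<rho>) \<le> (\<integral>\<^sup>+p. ennreal (u p) \<partial>\<rho>)"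
    using u by (intro nn_integral_mono ennreal_leI)
  also have "\<dots> = ennreal (\<integral>p. u p \<partial>\<rho>)"
    using u by (intro nn_integral_eq_integral int_u AE_I2) (meson exp_ge_zero order_trans)
  also have "(\<integral>p. u p \<partial>\<rho>) = 1 - 2 * e * h * G + q * (A * risk f + A * risk fH + 2 * B)"
    unfolding u_def using integrable_loss int_excess
    by (simp add: prob_space integral_excess G_def risk_eq)
  also have "\<dots> \<le> 1 + (- (e * h * G) + c3 * e\<^sup>2 * h\<^sup>2 * dist2 f)"
  proof -
    \<comment> \<open>Here \<open>risk f\<close> is split as \<open>G + risk fH\<close>, and
      \<open>risk fH\<close> is at most \<open>M\<close>.\<close>
    have "q * (A * risk f + A * risk fH + 2 * B) \<le> q * (A * G + (2 * A * M + 2 * B))"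
      using risk_fH_le A_pos q unfolding G_def by (intro mult_left_mono) (auto simp: algebra_simps)
    moreover have "q * (2 * A * M + 2 * B) = c3 * e\<^sup>2 * h\<^sup>2 * dist2 f"
      by (simp add: q_def c3_def)
    \<comment> \<open>The absorption: one of the two copies of \<open>e * h * G\<close> in the
      linear term is spent here.\<close>
    moreover have "q * (A * G) \<le> e * h * G"
    proof -
      have "4 * e * \<kappa>\<^sup>2 * A * (h * dist2 f) \<le> 4 * e * \<kappa>\<^sup>2 * A * c2"
        using D e A_pos by (intro mult_left_mono) auto
      then have "(e * h * G) * (4 * e * \<kappa>\<^sup>2 * A * (h * dist2 f)) \<le> (e * h * G) * 1"
        using ec e h G by (intro mult_left_mono) auto
      then show ?thesis by (simp add: q_def power2_eq_square mult_ac)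
    qed
    ultimately show ?thesis by (simp add: algebra_simps)
  qed
  also have "\<dots> \<le> exp (- (e * h * G) + c3 * e\<^sup>2 * h\<^sup>2 * dist2 f)"
    by (rule exp_ge_add_one_self)
  finally show ?thesis by (simp add: G_def ennreal_leI)
qed

section \<open>Choice of the exponents\<close>

definition e0 :: real where
  "e0 = 1 / (1 + 4 * eta 1 * M + 8 * \<kappa>\<^sup>2 * A * c2 + 4 * c3 * S2)"

text \<open>The exponent starts at \<open>2 * e0\<close> and loses
  \<open>c3 * (2 * e0)\<^sup>2 * (eta k)\<^sup>2\<close> at step \<open>k\<close>;
  square-summability keeps it above \<open>e0\<close>.\<close>

definition ep :: "nat \<Rightarrow> real" where
  "ep t = 2 * e0 - 4 * c3 * e0\<^sup>2 * (\<Sum>k\<in>{1..<t}. (eta k)\<^sup>2)"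

text \<open>The denominator of \<open>e0\<close> collects every quantity that must be dominated. The
  first two bounds are the smallness conditions of \<open>exp_excess_le\<close> at the largest
  exponent \<open>2 * e0\<close>, and the third keeps \<open>ep\<close> above
  \<open>e0\<close>.\<close>

lemma e0_pos: "0 < e0"
  and e0_M: "4 * e0 * eta 1 * M \<le> 1"
  and e0_c2: "8 * e0 * \<kappa>\<^sup>2 * A * c2 \<le> 1"
  and e0_S2: "4 * c3 * e0 * S2 \<le> 1"
proof -
  define a b c where "a = 4 * eta 1 * M" and "b = 8 * \<kappa>\<^sup>2 * A * c2" and "c = 4 * c3 * S2"
  have abc: "0 \<le> a" "0 \<le> b" "0 \<le> c"
    using M_nonneg eta_1_pos A_pos c2_nonneg c3_nonneg S2_nonneg by (simp_all add: a_def b_def c_def)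
  have e: "e0 = 1 / (1 + a + b + c)" by (simp add: e0_def a_def b_def c_def)
  show "0 < e0" using abc by (simp add: e)
  have "e0 * a \<le> 1" "e0 * b \<le> 1" "e0 * c \<le> 1" using abc by (simp_all add: e field_simps)
  then show "4 * e0 * eta 1 * M \<le> 1" "8 * e0 * \<kappa>\<^sup>2 * A * c2 \<le> 1" "4 * c3 * e0 * S2 \<le> 1"
    by (simp_all add: a_def b_def c_def mult_ac)
qed

lemma ep_ge: "e0 \<le> ep t"
proof -
  have "4 * c3 * e0\<^sup>2 * (\<Sum>k\<in>{1..<t}. (eta k)\<^sup>2) \<le> 4 * c3 * e0\<^sup>2 * S2"
    using c3_nonneg sum_eta_sq_le by (intro mult_left_mono) auto
  also have "\<dots> = e0 * (4 * c3 * e0 * S2)" by (simp add: power2_eq_square)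
  also have "\<dots> \<le> e0 * 1" using e0_S2 e0_pos by (intro mult_left_mono) auto
  finally show ?thesis by (simp add: ep_def)
qed

lemma ep_le: "ep t \<le> 2 * e0"
  using c3_nonneg by (simp add: ep_def sum_nonneg)

text \<open>The decrement is computed with the largest exponent \<open>2 * e0\<close>, so it
  dominates the variance factor at the actual exponent.\<close>

lemma ep_Suc:
  assumes "1 \<le> t"
  shows "ep (Suc t) + c3 * (ep (Suc t))\<^sup>2 * (eta t)\<^sup>2 \<le> ep t"
proof -
  have "(ep (Suc t))\<^sup>2 \<le> (2 * e0)\<^sup>2"
    using ep_le[of "Suc t"] ep_ge[of "Suc t"] e0_pos by (intro power_mono) auto
  then have "c3 * (ep (Suc t))\<^sup>2 * (eta t)\<^sup>2 \<le> c3 * (2 * e0)\<^sup>2 * (eta t)\<^sup>2"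
    using c3_nonneg by (intro mult_right_mono mult_left_mono) auto
  then show ?thesis using assms by (simp add: ep_def algebra_simps power_mult_distrib)
qed

section \<open>An exponential supermartingale for the weighted excess risk\<close>

definition gap_sum :: "(nat \<Rightarrow> 'a \<times> real) \<Rightarrow> nat \<Rightarrow> real" where
  "gap_sum z t = (\<Sum>k\<in>{1..<t}. eta k * (risk (iter z k) - risk fH))"

lemma iter_cong: "(\<And>i. 1 \<le> i \<Longrightarrow> i < t \<Longrightarrow> z i = z' i) \<Longrightarrow> iter z t = iter z' t"
  unfolding iter_def by (rule ogd_cong)

lemma
  assumes "\<And>i. 1 \<le> i \<Longrightarrow> i < t \<Longrightarrow> z i = z' i"
  shows gap_sum_cong: "gap_sum z t = gap_sum z' t" and Q_cong: "Q z t = Q z' t"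
proof -
  have 1: "iter z k = iter z' k \<and> z k = z' k" if "k \<in> {1..<t}" for k
    using that assms by (auto intro!: iter_cong)
  show "gap_sum z t = gap_sum z' t" unfolding gap_sum_def by (intro sum.cong) (auto simp: 1)
  have "(\<Sum>k\<in>{1..<t}. eta k * excess (iter z k) (z k)) = (\<Sum>k\<in>{1..<t}. eta k * excess (iter z' k) (z' k))"
    by (intro sum.cong) (auto simp: 1)
  then show "Q z t = Q z' t" by (simp add: Q_def)
qed

lemma gap_sum_Suc: "1 \<le> t \<Longrightarrow> gap_sum z (Suc t) = gap_sum z t + eta t * (risk (iter z t) - risk fH)"
  by (simp add: gap_sum_def)

lemma
  assumes "{1..<t} \<subseteq> J"
  shows measurable_gap_sum: "(\<lambda>z. gap_sum z t) \<in> borel_measurable (PiM J (\<lambda>_. \<rho>))"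
    and measurable_Q: "(\<lambda>z. Q z t) \<in> borel_measurable (PiM J (\<lambda>_. \<rho>))"
proof -
  have J: "(\<lambda>z. z i) \<in> measurable (PiM J (\<lambda>_. \<rho>)) \<rho>" if "1 \<le> i" "i < t" for i
    using that assms by (intro measurable_component_singleton) auto
  show "(\<lambda>z. gap_sum z t) \<in> borel_measurable (PiM J (\<lambda>_. \<rho>))"
    unfolding gap_sum_def
    by (intro borel_measurable_sum borel_measurable_times borel_measurable_const borel_measurable_diff
        measurable_risk_iter) (auto intro: J)
  show "(\<lambda>z. Q z t) \<in> borel_measurable (PiM J (\<lambda>_. \<rho>))"
    unfolding Q_def
    by (intro borel_measurable_sum borel_measurable_times borel_measurable_const borel_measurable_diff
        measurable_excess_iter) (auto intro: J)
qed

text \<open>Its exponential is a supermartingale. The excess risks carry the fixed weight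
  \<open>e0\<close>, while the decreasing weight \<open>ep t\<close> on \<open>Q\<close> pays for
  the variance.\<close>

definition potential :: "(nat \<Rightarrow> 'a \<times> real) \<Rightarrow> nat \<Rightarrow> real" where
  "potential z t = ep t * Q z t + e0 * gap_sum z t"

text \<open>Averaging over sample \<open>t\<close> yields \<open>- ep (Suc t) * eta t\<close> times
  the excess risk, which covers the growth of the \<open>gap_sum\<close> term because
  \<open>e0 \<le> ep (Suc t)\<close>. The variance is at most a multiple of \<open>Q z t\<close> and
  is covered by the drop of \<open>ep\<close>.\<close>

lemma potential_step:
  assumes t: "1 \<le> t" and z: "\<And>k. 1 \<le> k \<Longrightarrow> k < t \<Longrightarrow> z k \<in> space \<rho>"
  shows "(\<integral>\<^sup>+p. ennreal (exp (potential (z(t := p)) (Suc t))) \<partial>\<rho>) \<le> ennreal (exp (potential z t))"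
proof -
  define f e h where "f = iter z t" and "e = ep (Suc t)" and "h = eta t"
  define G where "G = risk f - risk fH"
  have G: "0 \<le> G" using fH_min by (simp add: G_def)
  have e: "e0 \<le> e" "e \<le> 2 * e0" "0 \<le> e" and h: "0 < h" "h \<le> eta 1"
    using ep_ge ep_le[of "Suc t"] e0_pos eta_pos[OF t] eta_le_1[OF t]
    by (auto simp: e_def h_def intro: order_trans[OF less_imp_le[OF e0_pos]])
  have eq: "iter (z(t := p)) t = f" "Q (z(t := p)) t = Q z t" "gap_sum (z(t := p)) t = gap_sum z t" for p
    unfolding f_def by (auto intro: iter_cong Q_cong gap_sum_cong)
  \<comment> \<open>\<open>V\<close> gathers everything that does not depend on the new
    sample.\<close>
  define V where "V = e * Q z t + e0 * gap_sum z t + e0 * h * G"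
  have pot: "potential (z(t := p)) (Suc t) = V + - (2 * e * h * excess f p)" for p
    unfolding potential_def Q_Suc[OF t] gap_sum_Suc[OF t] eq V_def
    by (simp add: G_def e_def h_def algebra_simps)
  have "(\<integral>\<^sup>+p. ennreal (exp (potential (z(t := p)) (Suc t))) \<partial>\<rho>)
      = (\<integral>\<^sup>+p. ennreal (exp V) * ennreal (exp (- (2 * e * h * excess f p))) \<partial>\<rho>)"
    by (simp only: pot exp_add ennreal_mult exp_ge_zero)
  also have "\<dots> = ennreal (exp V) * (\<integral>\<^sup>+p. ennreal (exp (- (2 * e * h * excess f p))) \<partial>\<rho>)"
    unfolding excess_def by (intro nn_integral_cmult) simp
  also have "\<dots> \<le> ennreal (exp V) * ennreal (exp (- (e * h * (risk f - risk fH)) + c3 * e\<^sup>2 * h\<^sup>2 * dist2 f))"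
  proof (intro mult_left_mono exp_excess_le)
    show "h * dist2 f \<le> c2" unfolding h_def f_def by (rule eta_dist2_le[of t z, OF t z])
    have "2 * e * h * M \<le> 2 * (2 * e0) * eta 1 * M"
      using e h e0_pos M_nonneg by (intro mult_right_mono mult_mono) auto
    then show "2 * e * h * M \<le> 1" using e0_M by linarith
    have "4 * e * \<kappa>\<^sup>2 * A * c2 \<le> 4 * (2 * e0) * \<kappa>\<^sup>2 * A * c2"
      using e A_pos c2_nonneg by (intro mult_right_mono mult_left_mono) auto
    then show "4 * e * \<kappa>\<^sup>2 * A * c2 \<le> 1" using e0_c2 by linarith
  qed (use e h in auto)
  also have "\<dots> = ennreal (exp (V + (- (e * h * G) + c3 * e\<^sup>2 * h\<^sup>2 * dist2 f)))"
    by (simp only: exp_add[of V] ennreal_mult exp_ge_zero G_def)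
  also have "\<dots> \<le> ennreal (exp (potential z t))"
  proof (intro ennreal_leI, subst exp_le_cancel_iff)
    have DQ: "dist2 f \<le> Q z t" unfolding f_def by (rule dist2_le_Q[of t z, OF t z])
    then have "c3 * e\<^sup>2 * h\<^sup>2 * dist2 f \<le> c3 * e\<^sup>2 * h\<^sup>2 * Q z t"
      using c3_nonneg by (intro mult_left_mono) auto
    \<comment> \<open>Multiplying \<open>ep_Suc\<close> by \<open>Q z t\<close> requires
      \<open>0 \<le> Q z t\<close>, which holds because \<open>Q z t\<close> dominates a squared
      distance.\<close>
    moreover have "(e + c3 * e\<^sup>2 * h\<^sup>2) * Q z t \<le> ep t * Q z t"
      using ep_Suc[OF t] DQ dist2_nonneg[of f] unfolding e_def h_def by (intro mult_right_mono) auto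
    moreover have "e0 * (h * G) \<le> e * (h * G)"
      using e h G by (intro mult_right_mono) auto
    ultimately show "V + (- (e * h * G) + c3 * e\<^sup>2 * h\<^sup>2 * dist2 f) \<le> potential z t"
      unfolding V_def potential_def by (simp add: algebra_simps)
  qed
  finally show ?thesis .
qed

lemma measurable_potential:
  "{1..<t} \<subseteq> J \<Longrightarrow> (\<lambda>z. ennreal (exp (potential z t))) \<in> borel_measurable (PiM J (\<lambda>_. \<rho>))"
  unfolding potential_def
  by (intro measurable_compose[OF _ measurable_ennreal] measurable_compose[OF _ borel_measurable_exp]
      borel_measurable_add borel_measurable_times borel_measurable_const measurable_Q measurable_gap_sum)

text \<open>Fubini integrates out the last sample first, and \<open>potential_step\<close> then
  lowers the index by one.\<close>

lemma potential_moment_le: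
  "(\<integral>\<^sup>+z. ennreal (exp (potential z (Suc n))) \<partial>(PiM {1..n} (\<lambda>_. \<rho>))) \<le> ennreal (exp (2 * e0 * C0))"
proof (induction n)
  case 0
  \<comment> \<open>Before the first sample all sums are empty and
    \<open>ep 1 = 2 * e0\<close>.\<close>
  have "potential z 1 = 2 * e0 * C0" for z by (simp add: potential_def ep_def Q_def gap_sum_def)
  then show ?case by (simp add: PiM_empty nn_integral_count_space_finite)
next
  case (Suc n)
  interpret product_sigma_finite "\<lambda>_::nat. \<rho>" by standard
  have ins: "{1..Suc n} = insert (Suc n) {1..n}" by auto
  have "(\<integral>\<^sup>+z. ennreal (exp (potential z (Suc (Suc n)))) \<partial>(PiM {1..Suc n} (\<lambda>_. \<rho>)))
      = (\<integral>\<^sup>+z. (\<integral>\<^sup>+p. ennreal (exp (potential (z(Suc n := p)) (Suc (Suc n)))) \<partial>\<rho>) \<partial>(PiM {1..n} (\<lambda>_. \<rho>)))"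
    unfolding ins
    by (intro product_nn_integral_insert measurable_potential) auto
  also have "\<dots> \<le> (\<integral>\<^sup>+z. ennreal (exp (potential z (Suc n))) \<partial>(PiM {1..n} (\<lambda>_. \<rho>)))"
  proof (intro nn_integral_mono potential_step)
    fix z :: "nat \<Rightarrow> 'a \<times> real" and k assume "z \<in> space (PiM {1..n} (\<lambda>_. \<rho>))" "1 \<le> k" "k < Suc n"
    then show "z k \<in> space \<rho>" by (auto simp: space_PiM)
  qed simp
  also note Suc.IH
  finally show ?case .
qed

text \<open>The integrand depends on finitely many coordinates, so restricting to
  \<open>{1..T}\<close> carries the finite product bound over to the infinite product.\<close>

lemma gap_sum_moment:
  "(\<integral>\<^sup>+z. ennreal (exp (e0 * gap_sum z (Suc T))) \<partial>(PiM UNIV (\<lambda>_. \<rho>))) \<le> ennreal (exp (2 * e0 * C0))"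
proof -
  interpret product_prob_space "\<lambda>_::nat. \<rho>" UNIV by standard
  let ?r = "\<lambda>z. restrict z {1..T}"
  have "(\<integral>\<^sup>+z. ennreal (exp (e0 * gap_sum z (Suc T))) \<partial>(PiM UNIV (\<lambda>_. \<rho>)))
      \<le> (\<integral>\<^sup>+z. ennreal (exp (potential (?r z) (Suc T))) \<partial>(PiM UNIV (\<lambda>_. \<rho>)))"
  proof (intro nn_integral_mono ennreal_leI, subst exp_le_cancel_iff)
    fix z :: "nat \<Rightarrow> 'a \<times> real" assume "z \<in> space (PiM UNIV (\<lambda>_. \<rho>))"
    then have z: "z k \<in> space \<rho>" for k by (auto simp: space_PiM)
    \<comment> \<open>Nonnegativity of \<open>Q\<close> allows the distance part of the potential to
      be dropped.\<close>
    have "0 \<le> Q z (Suc T)"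
      by (rule order_trans[OF dist2_nonneg dist2_le_Q[of "Suc T" z]]) (use z in auto)
    then have "0 \<le> ep (Suc T) * Q z (Suc T)"
      using ep_ge[of "Suc T"] e0_pos by simp
    moreover have "potential (?r z) (Suc T) = ep (Suc T) * Q z (Suc T) + e0 * gap_sum z (Suc T)"
      unfolding potential_def using Q_cong[of "Suc T" "?r z" z] gap_sum_cong[of "Suc T" "?r z" z] by simp
    ultimately show "e0 * gap_sum z (Suc T) \<le> potential (?r z) (Suc T)" by simp
  qed
  also have "\<dots> = (\<integral>\<^sup>+z. ennreal (exp (potential z (Suc T))) \<partial>(distr (PiM UNIV (\<lambda>_. \<rho>)) (PiM {1..T} (\<lambda>_. \<rho>)) ?r))"
    by (rule nn_integral_distr[symmetric, unfolded measurable_distr_eq1,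
          OF measurable_restrict_subset measurable_potential]) auto
  also have "\<dots> = (\<integral>\<^sup>+z. ennreal (exp (potential z (Suc T))) \<partial>(PiM {1..T} (\<lambda>_. \<rho>)))"
    by (subst distr_PiM_restrict_finite) auto
  also note potential_moment_le
  finally show ?thesis .
qed

text \<open>Markov's inequality for the exponential of \<open>e0 * gap_sum\<close>.\<close>

lemma gap_sum_tail:
  assumes \<delta>: "0 < \<delta>"
  shows "measure (PiM UNIV (\<lambda>_. \<rho>))
      {z \<in> space (PiM UNIV (\<lambda>_. \<rho>)). gap_sum z (Suc T) \<le> 2 * C0 + ln (1 / \<delta>) / e0} \<ge> 1 - \<delta>"
proof -
  interpret P: product_prob_space "\<lambda>_::nat. \<rho>" UNIV by standard
  let ?P = "PiM UNIV (\<lambda>_::nat. \<rho>)"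
  \<comment> \<open>Chosen so that \<open>exp (- (e0 * b))\<close> times the moment bound
    \<open>exp (2 * e0 * C0)\<close> equals \<open>\<delta>\<close>.\<close>
  define b where "b = 2 * C0 + ln (1 / \<delta>) / e0"
  define W where "W = (\<lambda>z. gap_sum z (Suc T))"
  have [measurable]: "W \<in> borel_measurable ?P"
    unfolding W_def by (intro measurable_gap_sum) auto
  have bad: "{z \<in> space ?P. b < W z} \<in> sets ?P" by measurable
  have "emeasure ?P {z \<in> space ?P. b < W z} = (\<integral>\<^sup>+z. indicator {z \<in> space ?P. b < W z} z \<partial>?P)"
    using bad by simp
  also have "\<dots> \<le> (\<integral>\<^sup>+z. ennreal (exp (- (e0 * b))) * ennreal (exp (e0 * W z)) \<partial>?P)"
  proof (intro nn_integral_mono)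
    fix z
    have "(1::ennreal) \<le> ennreal (exp (- (e0 * b))) * ennreal (exp (e0 * W z))" if "b < W z"
    proof -
      have "e0 * b \<le> e0 * W z" using that e0_pos by simp
      then have "1 \<le> exp (- (e0 * b)) * exp (e0 * W z)" by (simp add: exp_add[symmetric])
      then show ?thesis by (simp add: ennreal_mult[symmetric])
    qed
    then show "indicator {z \<in> space ?P. b < W z} z \<le> ennreal (exp (- (e0 * b))) * ennreal (exp (e0 * W z))"
      by (auto simp: indicator_def)
  qed
  also have "\<dots> = ennreal (exp (- (e0 * b))) * (\<integral>\<^sup>+z. ennreal (exp (e0 * W z)) \<partial>?P)"
    by (intro nn_integral_cmult) measurable
  also have "\<dots> \<le> ennreal (exp (- (e0 * b))) * ennreal (exp (2 * e0 * C0))"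
    unfolding W_def by (intro mult_left_mono gap_sum_moment) simp
  also have "\<dots> = ennreal (exp (- (e0 * b) + 2 * e0 * C0))"
    by (simp only: exp_add ennreal_mult exp_ge_zero)
  also have "- (e0 * b) + 2 * e0 * C0 = ln \<delta>"
    using e0_pos \<delta> by (simp add: b_def ln_div algebra_simps)
  also have "exp (ln \<delta>) = \<delta>" using \<delta> by simp
  finally have "P.prob {z \<in> space ?P. b < W z} \<le> \<delta>"
    using \<delta> by (simp add: P.emeasure_eq_measure)
  moreover have "{z \<in> space ?P. W z \<le> b} = space ?P - {z \<in> space ?P. b < W z}" by auto
  ultimately show ?thesis
    using P.prob_compl[OF bad] by (simp add: W_def b_def)
qed

subsection \<open>The averaged iterate\<close>

text \<open>Jensen's inequality for the loss at each sample point, then integrated.\<close>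

lemma risk_wavg_le:
  assumes T: "1 \<le> T"
  shows "risk (wavg eta f T) - risk fH
    \<le> (\<Sum>t=1..T. eta t * (risk (f t) - risk fH)) / (\<Sum>t=1..T. eta t)"
proof -
  define H where "H = (\<Sum>t=1..T. eta t)"
  have H: "0 < H" unfolding H_def using T eta_pos by (intro sum_pos) auto
  define w where "w t = eta t / H" for t
  have w: "(\<Sum>t=1..T. w t) = 1" "\<And>t. t \<in> {1..T} \<Longrightarrow> 0 \<le> w t"
    using H eta_pos by (auto simp: w_def sum_divide_distrib[symmetric] H_def less_imp_le)
  have avg: "wavg eta f T = (\<Sum>t=1..T. w t *\<^sub>R f t)"
    by (simp add: wavg_def w_def H_def scaleR_sum_right)
  have "loss (wavg eta f T) p \<le> (\<Sum>t=1..T. w t * loss (f t) p)" if p: "p \<in> space \<rho>" for p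
  proof -
    have "phi (snd p) (\<Sum>t=1..T. w t *\<^sub>R inner (f t) (kx (fst p)))
        \<le> (\<Sum>t=1..T. w t * phi (snd p) (inner (f t) (kx (fst p))))"
      using phi_convex fst_snd_mem[OF p] w T by (intro convex_on_sum) auto
    then show ?thesis by (simp add: loss_def avg inner_sum_left)
  qed
  then have "risk (wavg eta f T) \<le> (\<integral>p. (\<Sum>t=1..T. w t * loss (f t) p) \<partial>\<rho>)"
    unfolding risk_eq using integrable_loss by (intro integral_mono) auto
  also have "\<dots> = (\<Sum>t=1..T. w t * risk (f t))"
    unfolding risk_eq using integrable_loss by (subst Bochner_Integration.integral_sum) auto
  finally have "risk (wavg eta f T) - risk fH \<le> (\<Sum>t=1..T. w t * risk (f t)) - (\<Sum>t=1..T. w t) * risk fH"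
    unfolding w by simp
  also have "\<dots> = (\<Sum>t=1..T. w t * (risk (f t) - risk fH))"
    by (simp add: sum_distrib_right sum_subtractf[symmetric] right_diff_distrib)
  also have "\<dots> = (\<Sum>t=1..T. eta t * (risk (f t) - risk fH)) / H"
    by (simp add: w_def sum_divide_distrib)
  finally show ?thesis by (simp add: H_def)
qed

text \<open>One event serves both estimates: the second follows from the first through
  \<open>risk_wavg_le\<close>. What remains is to rewrite a tail bound linear in
  \<open>ln (1 / \<delta>)\<close> with the power 3/2.\<close>

lemma high_probability_bound:
  "\<exists>C. \<forall>T \<delta>. T \<ge> 1 \<longrightarrow> 0 < \<delta> \<longrightarrow> \<delta> < 1 \<longrightarrow>
     (\<exists>S \<in> sets (PiM (UNIV::nat set) (\<lambda>_. \<rho>)).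
        measure (PiM (UNIV::nat set) (\<lambda>_. \<rho>)) S \<ge> 1 - \<delta> \<and>
        (\<forall>z \<in> S.
           (\<Sum>t=1..T. eta t * (risk (ogd kx dphi eta z t) - risk fH))
             \<le> C * (ln (2 * real T / \<delta>)) powr (3/2)
         \<and> risk (wavg eta (ogd kx dphi eta z) T) - risk fH
             \<le> C * (ln (2 * real T / \<delta>)) powr (3/2) / (\<Sum>t=1..T. eta t)))"
proof (intro exI allI impI)
  fix T :: nat and \<delta> :: real
  assume T: "1 \<le> T" and \<delta>: "0 < \<delta>" "\<delta> < 1"
  let ?P = "PiM UNIV (\<lambda>_::nat. \<rho>)"
  \<comment> \<open>The factor \<open>1 / ln 2\<close> turns the constant \<open>2 * C0\<close> into
    a multiple of \<open>l\<close>, and \<open>1 / sqrt (ln 2)\<close> raises \<open>l\<close> to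
    \<open>l * sqrt l\<close>; both use \<open>ln 2 \<le> l\<close>. The value mentions neither
    \<open>T\<close> nor \<open>\<delta>\<close>, so it can instantiate the outer existential
    quantifier.\<close>
  define c where "c = (2 * C0 / ln 2 + 1 / e0) / sqrt (ln 2)"
  define l where "l = ln (2 * real T / \<delta>)"
  define b where "b = 2 * C0 + ln (1 / \<delta>) / e0"
  define S where "S = {z \<in> space ?P. gap_sum z (Suc T) \<le> b}"
  have l1: "ln 2 \<le> l" and l2: "ln (1 / \<delta>) \<le> l"
    using T \<delta> unfolding l_def by (auto simp: field_simps intro!: ln_mono)
  have b: "b \<le> c * l powr (3/2)"
  proof -
    have ln2: "(0::real) < ln 2" by simp
    then have l: "0 < l" using l1 by linarith
    have "2 * C0 * ln 2 \<le> 2 * C0 * l" using l1 C0_nonneg by (intro mult_left_mono) auto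
    then have "2 * C0 \<le> 2 * C0 / ln 2 * l" using ln2 by (simp add: field_simps)
    moreover have "ln (1 / \<delta>) / e0 \<le> 1 / e0 * l" using l2 e0_pos by (simp add: divide_right_mono)
    ultimately have "b \<le> (2 * C0 / ln 2 + 1 / e0) * l" unfolding b_def by (simp add: distrib_right)
    also have "\<dots> = c * (l * sqrt (ln 2))" using ln2 by (simp add: c_def)
    also have "\<dots> \<le> c * (l * sqrt l)"
    proof (intro mult_left_mono)
      show "sqrt (ln 2) \<le> sqrt l" using l1 by simp
      show "0 \<le> l" using l by simp
      show "0 \<le> c" using C0_nonneg e0_pos by (simp add: c_def)
    qed
    also have "l * sqrt l = l powr (3/2)"
      using l powr_add[of l 1 "1/2"] by (simp add: powr_half_sqrt)
    finally show ?thesis .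
  qed
  \<comment> \<open>The half-open range in \<open>gap_sum z (Suc T)\<close> is
    \<open>{1..T}\<close>.\<close>
  have main: "(\<Sum>t=1..T. eta t * (risk (ogd kx dphi eta z t) - risk fH)) \<le> c * l powr (3/2)"
    if "z \<in> S" for z
    using that b unfolding S_def gap_sum_def iter_def by (auto simp: atLeastLessThanSuc_atLeastAtMost)
  have avg: "risk (wavg eta (ogd kx dphi eta z) T) - risk fH \<le> c * l powr (3/2) / (\<Sum>t=1..T. eta t)"
    if "z \<in> S" for z
    using risk_wavg_le[OF T, of "ogd kx dphi eta z"] divide_right_mono[OF main[OF that]]
      sum_nonneg[of "{1..T}" eta] eta_pos by (smt (verit) atLeastAtMost_iff)
  have "(\<lambda>z. gap_sum z (Suc T)) \<in> borel_measurable ?P" by (intro measurable_gap_sum) auto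
  then have "S \<in> sets ?P" unfolding S_def by measurable
  moreover have "1 - \<delta> \<le> measure ?P S"
    unfolding S_def b_def by (rule gap_sum_tail[OF \<delta>(1)])
  ultimately show "\<exists>S \<in> sets ?P. measure ?P S \<ge> 1 - \<delta> \<and> (\<forall>z \<in> S.
           (\<Sum>t=1..T. eta t * (risk (ogd kx dphi eta z t) - risk fH))
             \<le> c * (ln (2 * real T / \<delta>)) powr (3/2)
         \<and> risk (wavg eta (ogd kx dphi eta z) T) - risk fH
             \<le> c * (ln (2 * real T / \<delta>)) powr (3/2) / (\<Sum>t=1..T. eta t))"
    using main avg unfolding l_def by blast
qed

end

section \<open>Reduction of Hoelder smooth losses to the self-bounding setting\<close>

theorem theorem5:
  fixes X :: "'a::euclidean_space set" and Y :: "real set"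
    and \<rho> :: "('a \<times> real) measure"
    and kx :: "'a \<Rightarrow> 'h::{real_inner, complete_space}"
    and phi dphi :: "real \<Rightarrow> real \<Rightarrow> real"
    and \<alpha> L :: real and eta :: "nat \<Rightarrow> real" and fH :: 'h
  assumes rho_prob: "prob_space \<rho>"
    and rho_sets: "sets \<rho> = sets (restrict_space borel (X \<times> Y))"
    and K_cont: "continuous_on (X \<times> X) (\<lambda>(x, x'). kern kx x x')"
    and rkhs_dense: "closure (span (kx ` X)) = UNIV"
    and kappa_fin: "bdd_above ((\<lambda>x. sqrt (kern kx x x)) ` X)"
    and phi_nonneg: "\<And>y s. y \<in> Y \<Longrightarrow> phi y s \<ge> 0"
    and phi_meas: "(\<lambda>(y, s). phi y s) \<in> borel_measurable (restrict_space borel (Y \<times> UNIV))"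
    and phi_deriv: "\<And>y s. y \<in> Y \<Longrightarrow> (phi y has_real_derivative dphi y s) (at s)"
    and phi_convex: "\<And>y. y \<in> Y \<Longrightarrow> convex_on UNIV (phi y)"
    and alpha: "0 < \<alpha>" "\<alpha> \<le> 1" and L_pos: "L > 0"
    and hoelder: "\<And>y s s'. y \<in> Y \<Longrightarrow> \<bar>dphi y s - dphi y s'\<bar> \<le> L * \<bar>s - s'\<bar> powr \<alpha>"
    and fH_min: "\<And>f::'h. gen_err \<rho> phi (evalf kx fH) \<le> gen_err \<rho> phi (evalf kx f)"
    and bdd0: "bdd_above ((\<lambda>y. phi y 0) ` Y)"
    and bddH: "bdd_above ((\<lambda>(x, y). phi y (evalf kx fH x)) ` (X \<times> Y))"
    and eta_pos: "\<And>t. t \<ge> 1 \<Longrightarrow> eta t > 0"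
    and eta_le: "\<And>t. t \<ge> 1 \<Longrightarrow> eta t * (constA \<alpha> L * (kappa kx X)\<^sup>2) \<le> 1"
    and eta_mono: "\<And>t. t \<ge> 1 \<Longrightarrow> eta (Suc t) \<le> eta t"
    and eta_sq: "summable (\<lambda>t. (eta t)\<^sup>2)"
  shows "\<exists>C::real. \<forall>T::nat. \<forall>\<delta>::real. T \<ge> 1 \<longrightarrow> 0 < \<delta> \<longrightarrow> \<delta> < 1 \<longrightarrow>
     (\<exists>S \<in> sets (PiM (UNIV::nat set) (\<lambda>_. \<rho>)).
        measure (PiM (UNIV::nat set) (\<lambda>_. \<rho>)) S \<ge> 1 - \<delta> \<and>
        (\<forall>z \<in> S.
           (\<Sum>t=1..T. eta t * (gen_err \<rho> phi (evalf kx (ogd kx dphi eta z t))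
                                 - gen_err \<rho> phi (evalf kx fH)))
             \<le> C * (ln (2 * real T / \<delta>)) powr (3/2)
         \<and> gen_err \<rho> phi (evalf kx (wavg eta (ogd kx dphi eta z) T)) - gen_err \<rho> phi (evalf kx fH)
             \<le> C * (ln (2 * real T / \<delta>)) powr (3/2) / (\<Sum>t=1..T. eta t)))"
proof -
  interpret prob_space \<rho> by (rule rho_prob)
  obtain B where B: "0 \<le> B"
    and self_bounding: "\<And>g g' s. (\<And>s. 0 \<le> g s) \<Longrightarrow> (\<And>s. (g has_real_derivative g' s) (at s)) \<Longrightarrow>
      convex_on UNIV g \<Longrightarrow> (\<And>s s'. \<bar>g' s - g' s'\<bar> \<le> L * \<bar>s - s'\<bar> powr \<alpha>) \<Longrightarrow>
      (g' s)\<^sup>2 \<le> constA \<alpha> L * g s + B"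
    using hoelder_self_bounding[OF alpha L_pos] by metis
  obtain M0 where M0: "\<And>y. y \<in> Y \<Longrightarrow> phi y 0 \<le> M0"
    using bdd0 by (auto simp: bdd_above_def)
  obtain MH where MH: "\<And>x y. x \<in> X \<Longrightarrow> y \<in> Y \<Longrightarrow> phi y (inner fH (kx x)) \<le> MH"
    using bddH by (auto simp: bdd_above_def evalf_def)
  \<comment> \<open>\<open>max M0 MH\<close> bounds both reference losses at once, and each feature
    norm is below the supremum \<open>kappa kx X\<close> because \<open>sqrt (kern kx x x)\<close>
    is the norm of \<open>kx x\<close>.\<close>
  interpret self_bounding_ogd \<rho> X Y kx phi dphi "constA \<alpha> L" B "kappa kx X" "max M0 MH" eta fH
  proof
    show "norm (kx x) \<le> kappa kx X" if "x \<in> X" for x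
      using cSUP_upper[OF that kappa_fin] by (simp add: kappa_def kern_def norm_eq_sqrt_inner)
    show "(dphi y s)\<^sup>2 \<le> constA \<alpha> L * phi y s + B" if "y \<in> Y" for y s
      using that by (intro self_bounding phi_nonneg phi_deriv phi_convex hoelder)
    show "0 < constA \<alpha> L" using alpha(1) L_pos by (rule constA_pos)
    show "phi y 0 \<le> max M0 MH" if "y \<in> Y" for y using M0[OF that] by simp
    show "phi y (inner fH (kx x)) \<le> max M0 MH" if "x \<in> X" "y \<in> Y" for x y
      using MH[OF that] by simp
  qed (fact rho_sets K_cont phi_nonneg phi_meas phi_deriv phi_convex B fH_min eta_pos eta_le
      eta_mono eta_sq)+
  show ?thesis by (rule high_probability_bound)
qed

end
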